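(* There exists an absolute numerical constant $C>0$ such that the following holds. Let $f:\mathbb{R}^d\to\mathbb{R}$ be $(L_0,L_1)$-smooth with $f^\star=\inf_{\mathbf{x}} f(\mathbf{x})>-\infty$, let $c>0$, let $0<\eta\le \frac{1}{9(L_0+cL_1)}$, let $\mathbf{x}_0\in\mathbb{R}^d$, and let $\mathbf{x}_{t+1}=\mathbf{x}_t-\eta\,\mathrm{clip}_c(\nabla f(\mathbf{x}_t))$ for $t\ge 0$ be the iterates of clipped gradient descent with deterministic gradients. Then for every integer $T\ge 1$, $$\frac1T\sum_{t=1}^T\|\nabla f(\mathbf{x}_t)\|\;\le\; C\left(\sqrt{\frac{F_0}{\eta T}}+\frac{F_0}{\eta T c}\right),\qquad F_0=f(\mathbf{x}_0)-f^\star.$$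
   Context: $\|\cdot\|$ is the Euclidean norm. $(L_0,L_1)$-smoothness, for constants $L_0,L_1\ge 0$: $f$ is differentiable and $\|\nabla f(\mathbf{x})-\nabla f(\mathbf{y})\|\le (L_0+L_1\|\nabla f(\mathbf{x})\|)\,\|\mathbf{x}-\mathbf{y}\|$ for all $\mathbf{x},\mathbf{y}\in\mathbb{R}^d$ with $\|\mathbf{x}-\mathbf{y}\|\le 1/L_1$ (with $1/L_1=+\infty$ if $L_1=0$). Clipping operator: $\mathrm{clip}_c(\mathbf{u})=\min\big(1,\frac{c}{\|\mathbf{u}\|}\big)\mathbf{u}$ (with $\mathrm{clip}_c(0)=0$). *)

theory Defs
  imports "HOL-Analysis.Analysis"
begin

text \<open>
  The constant of the theorem is absolute, in particular independent of the dimension, so the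
  dimension has to be quantified inside the formula and cannot be a type parameter. Hence
  \<open>\<real>\<^sup>d\<close> is the carrier of the library's \<^const>\<open>Euclidean_space\<close>: the sequences that vanish
  from index \<open>d\<close> on.
\<close>

abbreviation Rn :: "nat \<Rightarrow> (nat \<Rightarrow> real) set" where
  "Rn d \<equiv> topspace (Euclidean_space d)"

abbreviation enorm :: "nat \<Rightarrow> (nat \<Rightarrow> real) \<Rightarrow> real" where
  "enorm d x \<equiv> L2_set x {..<d}"

abbreviation edist :: "nat \<Rightarrow> (nat \<Rightarrow> real) \<Rightarrow> (nat \<Rightarrow> real) \<Rightarrow> real" where
  "edist d x y \<equiv> enorm d (\<lambda>i. x i - y i)"

text \<open>
  Frechet differentiability with gradient \<open>g\<close>, written like \<open>has_derivative_at_alt\<close>; only the values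
  of \<open>f\<close> on \<open>\<real>\<^sup>d\<close> matter.
\<close>

definition has_gradient ::
    "nat \<Rightarrow> ((nat \<Rightarrow> real) \<Rightarrow> real) \<Rightarrow> (nat \<Rightarrow> real) \<Rightarrow> (nat \<Rightarrow> real) \<Rightarrow> bool" where
  "has_gradient d f x g \<longleftrightarrow> g \<in> Rn d \<and>
     (\<forall>e>0. \<exists>r>0. \<forall>y\<in>Rn d. edist d y x < r \<longrightarrow>
        \<bar>f y - f x - (\<Sum>i<d. g i * (y i - x i))\<bar> \<le> e * edist d y x)"

definition grad :: "nat \<Rightarrow> ((nat \<Rightarrow> real) \<Rightarrow> real) \<Rightarrow> (nat \<Rightarrow> real) \<Rightarrow> nat \<Rightarrow> real" where
  "grad d f x = (THE g. has_gradient d f x g)"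

text \<open>The first disjunct \<open>L1 = 0\<close> implements the convention \<open>1 / 0 = \<infinity>\<close>.\<close>

definition L0_L1_smooth :: "nat \<Rightarrow> real \<Rightarrow> real \<Rightarrow> ((nat \<Rightarrow> real) \<Rightarrow> real) \<Rightarrow> bool" where
  "L0_L1_smooth d L0 L1 f \<longleftrightarrow>
     (\<forall>x\<in>Rn d. \<exists>g. has_gradient d f x g) \<and>
     (\<forall>x\<in>Rn d. \<forall>y\<in>Rn d. L1 = 0 \<or> edist d x y \<le> 1 / L1 \<longrightarrow>
        edist d (grad d f x) (grad d f y) \<le> (L0 + L1 * enorm d (grad d f x)) * edist d x y)"

definition clip :: "nat \<Rightarrow> real \<Rightarrow> (nat \<Rightarrow> real) \<Rightarrow> nat \<Rightarrow> real" where
  "clip d c u = (\<lambda>i. min 1 (c / enorm d u) * u i)"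

lemma has_gradient_unique:
  assumes x: "x \<in> Rn d" and g: "has_gradient d f x g" and h: "has_gradient d f x h"
  shows "g = h"
proof (rule ccontr)
  assume "g \<noteq> h"
  define v where "v = (\<lambda>i. g i - h i)"
  define n where "n = enorm d v"
  have gR: "\<forall>i\<ge>d. g i = 0" "\<forall>i\<ge>d. h i = 0" "\<forall>i\<ge>d. x i = 0"
    using g h x by (auto simp: has_gradient_def topspace_Euclidean_space)
  have "n \<noteq> 0"
  proof
    assume "n = 0"
    then have "\<forall>i<d. g i = h i" by (auto simp: n_def v_def L2_set_eq_0_iff)
    then have "g = h" using gR by (metis ext linorder_not_le)
    with \<open>g \<noteq> h\<close> show False ..
  qed
  then have n: "n > 0" using L2_set_nonneg[of v "{..<d}"] by (simp add: n_def less_le)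
  then have e: "n / 4 > 0" by simp
  obtain r1 where r1: "r1 > 0" "\<And>y. y \<in> Rn d \<Longrightarrow> edist d y x < r1 \<Longrightarrow>
      \<bar>f y - f x - (\<Sum>i<d. g i * (y i - x i))\<bar> \<le> n / 4 * edist d y x"
    using g e unfolding has_gradient_def by meson
  obtain r2 where r2: "r2 > 0" "\<And>y. y \<in> Rn d \<Longrightarrow> edist d y x < r2 \<Longrightarrow>
      \<bar>f y - f x - (\<Sum>i<d. h i * (y i - x i))\<bar> \<le> n / 4 * edist d y x"
    using h e unfolding has_gradient_def by meson
  define s where "s = min r1 r2 / (2 * n)"
  have s: "s > 0" using r1 r2 n by (simp add: s_def)
  define y where "y = (\<lambda>i. x i + s * v i)"
  have yR: "y \<in> Rn d" using gR by (simp add: y_def v_def topspace_Euclidean_space)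
  have dist: "edist d y x = s * n"
    using s by (simp add: y_def n_def L2_set_right_distrib)
  have lt: "s * n < r1" "s * n < r2" using r1(1) r2(1) n by (auto simp: s_def)
  have "(\<Sum>i<d. g i * (y i - x i)) - (\<Sum>i<d. h i * (y i - x i)) = s * (\<Sum>i<d. (v i)\<^sup>2)"
    by (simp add: y_def v_def sum_subtractf[symmetric] sum_distrib_left power2_eq_square
        algebra_simps)
  also have "(\<Sum>i<d. (v i)\<^sup>2) = n\<^sup>2" by (simp add: n_def L2_set_def sum_nonneg)
  finally have "s * n\<^sup>2 \<le> n / 4 * (s * n) + n / 4 * (s * n)"
    using r1(2)[OF yR] r2(2)[OF yR] lt unfolding dist by linarith
  then have "s * n\<^sup>2 \<le> 0" by (simp add: power2_eq_square mult_ac)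
  then show False using s n by (simp add: mult_le_0_iff)
qed

lemma grad_eqI: "x \<in> Rn d \<Longrightarrow> has_gradient d f x g \<Longrightarrow> grad d f x = g"
  unfolding grad_def by (blast intro: has_gradient_unique)

text \<open>
  Agreement with the library: for every enumeration \<open>h\<close> of the coordinates of \<open>real ^ 'n\<close> the
  gradient above is the one of \<^const>\<open>gderiv\<close>.
\<close>

definition coords :: "(nat \<Rightarrow> 'n) \<Rightarrow> real ^ 'n \<Rightarrow> nat \<Rightarrow> real" where
  "coords h v = (\<lambda>i. if i < CARD('n) then v $ h i else 0)"

lemma coords_bij:
  assumes "bij_betw h {..<CARD('n::finite)} (UNIV :: 'n set)"
  shows "bij_betw (coords h) (UNIV :: (real ^ 'n) set) (Rn CARD('n))"
proof (rule bij_betw_byWitness)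
  let ?k = "inv_into {..<CARD('n)} h"
  let ?w = "\<lambda>x. \<chi> i. x (?k i)"
  have k: "?k i < CARD('n)" "h (?k i) = i" for i
    using bij_betwE[OF bij_betw_inv_into[OF assms]] bij_betw_inv_into_right[OF assms] by auto
  have k': "?k (h i) = i" if "i < CARD('n)" for i
    using bij_betw_inv_into_left[OF assms] that by auto
  show "\<forall>v\<in>UNIV. ?w (coords h v) = v" by (simp add: coords_def k vec_eq_iff)
  show "\<forall>x\<in>Rn CARD('n). coords h (?w x) = x"
    by (auto simp: coords_def k' topspace_Euclidean_space fun_eq_iff)
  show "range (coords h :: real ^ 'n \<Rightarrow> _) \<subseteq> Rn CARD('n)"
    by (auto simp: coords_def topspace_Euclidean_space)
  show "?w ` Rn CARD('n) \<subseteq> UNIV" by simp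
qed

lemma has_gradient_iff_GDERIV:
  fixes f :: "(nat \<Rightarrow> real) \<Rightarrow> real" and x g :: "real ^ 'n"
  assumes h: "bij_betw h {..<CARD('n)} UNIV"
  shows "has_gradient CARD('n) f (coords h x) (coords h g)
           \<longleftrightarrow> GDERIV (\<lambda>v. f (coords h v)) x :> g"
proof -
  have Rn_eq: "Rn CARD('n) = range (coords h :: real ^ 'n \<Rightarrow> _)"
    using coords_bij[OF h] by (simp add: bij_betw_def)
  have s: "(\<Sum>i<CARD('n). F (h i)) = (\<Sum>i\<in>UNIV. F i)" for F :: "'n \<Rightarrow> real"
    using h by (rule sum.reindex_bij_betw)
  have dist: "edist CARD('n) (coords h y) (coords h x) = norm (y - x)" for y :: "real ^ 'n"
    using s[of "\<lambda>i. (y $ i - x $ i)\<^sup>2"] by (simp add: L2_set_def norm_vec_def coords_def)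
  have inner: "(\<Sum>i<CARD('n). coords h g i * (coords h y i - coords h x i)) = inner (y - x) g"
    for y :: "real ^ 'n"
    using s[of "\<lambda>i. g $ i * (y $ i - x $ i)"]
    by (simp add: inner_vec_def coords_def mult.commute)
  show ?thesis
    unfolding has_gradient_def gderiv_def has_derivative_at_alt Rn_eq
    by (simp add: dist inner bounded_linear_inner_left)
qed

end

theory Submission
  imports Defs
begin

text \<open>
  Along a segment starting at \<open>x\<close> the gradient moves by at most \<open>(L0 + L1 * n)\<close> times the length of
  the segment, where \<open>n\<close> is the norm of the gradient at \<open>x\<close>. The bound on \<open>\<eta>\<close> makes this at most
  \<open>n / 9\<close> on a clipped step, so by the mean value theorem each step decreases \<open>f\<close> by at least
  \<open>\<eta> / 2 * min (n\<^sup>2) (c * n)\<close>. Telescoping bounds the average of these minima, and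
  \<open>n \<le> a / 2 + n\<^sup>2 / (2 * a)\<close> with the optimal \<open>a\<close> turns the quadratic branch into the square root.
\<close>

text \<open>Two points of the line at parameters \<open>u\<close> and \<open>t\<close> have distance
  \<open>\<bar>u - t\<bar> * enorm d v\<close>, so the remainder estimate of the gradient restricts
  to that of a one-variable derivative. This makes \<open>MVT2\<close> available on
  segments.\<close>

lemma has_gradient_DERIV_line:
  assumes x: "x \<in> Rn d" and v: "v \<in> Rn d"
    and g: "has_gradient d f (\<lambda>i. x i + t * v i) g"
  shows "((\<lambda>t. f (\<lambda>i. x i + t * v i)) has_real_derivative (\<Sum>i<d. g i * v i)) (at t)"
  unfolding has_field_derivative_def has_derivative_at_alt
proof (intro conjI allI impI)
  show "bounded_linear ((*) (\<Sum>i<d. g i * v i))"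
    by (rule bounded_linear_mult_right)
  fix e :: real
  assume e: "e > 0"
  define N where "N = enorm d v"
  have N: "N \<ge> 0" by (simp add: N_def L2_set_nonneg)
  \<comment> \<open>Dividing by \<open>N + 1\<close> instead of \<open>N\<close> covers
    \<open>v = 0\<close> as well; the radius is shrunk by the same factor.\<close>
  have "e / (N + 1) > 0" using e N by simp
  then obtain r where r: "r > 0" "\<And>y. y \<in> Rn d \<Longrightarrow> edist d y (\<lambda>i. x i + t * v i) < r \<Longrightarrow>
      \<bar>f y - f (\<lambda>i. x i + t * v i) - (\<Sum>i<d. g i * (y i - (x i + t * v i)))\<bar>
        \<le> e / (N + 1) * edist d y (\<lambda>i. x i + t * v i)"
    using g unfolding has_gradient_def by meson
  have "norm (f (\<lambda>i. x i + u * v i) - f (\<lambda>i. x i + t * v i) - (\<Sum>i<d. g i * v i) * (u - t))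
      \<le> e * norm (u - t)" if u: "norm (u - t) < r / (N + 1)" for u
  proof -
    have diff: "x i + u * v i - (x i + t * v i) = (u - t) * v i" for i
      by (simp add: algebra_simps)
    have dist: "edist d (\<lambda>i. x i + u * v i) (\<lambda>i. x i + t * v i) = \<bar>u - t\<bar> * N"
      unfolding diff N_def by (simp add: L2_set_def power_mult_distrib real_sqrt_mult
          flip: sum_distrib_left)
    have inner: "(\<Sum>i<d. g i * (x i + u * v i - (x i + t * v i))) = (\<Sum>i<d. g i * v i) * (u - t)"
      unfolding diff sum_distrib_right by (simp add: mult_ac)
    have "\<bar>u - t\<bar> * N \<le> \<bar>u - t\<bar> * (N + 1)" by (simp add: mult_left_mono)
    also have "\<dots> < r" using u N by (simp add: field_simps)
    finally have lt: "\<bar>u - t\<bar> * N < r" .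
    have mem: "(\<lambda>i. x i + u * v i) \<in> Rn d"
      using x v by (auto simp: topspace_Euclidean_space)
    have "\<bar>f (\<lambda>i. x i + u * v i) - f (\<lambda>i. x i + t * v i) - (\<Sum>i<d. g i * v i) * (u - t)\<bar>
        \<le> e / (N + 1) * (\<bar>u - t\<bar> * N)"
      using r(2)[OF mem] lt unfolding dist inner by blast
    also have "\<dots> = e * \<bar>u - t\<bar> * (N / (N + 1))" by simp
    also have "\<dots> \<le> e * \<bar>u - t\<bar> * 1"
      using e N by (intro mult_left_mono) auto
    finally show ?thesis by simp
  qed
  then show "\<exists>\<delta>>0. \<forall>u. norm (u - t) < \<delta> \<longrightarrow>
      norm (f (\<lambda>i. x i + u * v i) - f (\<lambda>i. x i + t * v i) - (\<Sum>i<d. g i * v i) * (u - t))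
        \<le> e * norm (u - t)"
    using r(1) N by (intro exI[of _ "r / (N + 1)"]) auto
qed

lemma L0_L1_smooth_has_gradient:
  assumes "L0_L1_smooth d L0 L1 f" "x \<in> Rn d"
  shows "has_gradient d f x (grad d f x)"
  using assms grad_eqI unfolding L0_L1_smooth_def by metis

text \<open>The mean value theorem gives a point \<open>y z\<close> on the segment whose gradient
  accounts for the change of \<open>f\<close>; smoothness and Cauchy-Schwarz bound the error of
  using the gradient at \<open>x\<close> instead. Compared with integrating along the segment this
  loses a factor 1/2 in the quadratic term, which the constant 9 in the step size absorbs.\<close>

lemma L0_L1_smooth_upper_bound:
  assumes smooth: "L0_L1_smooth d L0 L1 f" and "L0 \<ge> 0" "L1 \<ge> 0"
    and x: "x \<in> Rn d" and v: "v \<in> Rn d" and short: "L1 = 0 \<or> enorm d v \<le> 1 / L1"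
  shows "f (\<lambda>i. x i + v i) \<le> f x + (\<Sum>i<d. grad d f x i * v i)
           + (L0 + L1 * enorm d (grad d f x)) * (enorm d v)\<^sup>2"
proof -
  define y where "y = (\<lambda>t i. x i + t * v i)"
  define K where "K = L0 + L1 * enorm d (grad d f x)"
  have K: "K \<ge> 0" using \<open>L0 \<ge> 0\<close> \<open>L1 \<ge> 0\<close> by (simp add: K_def L2_set_nonneg)
  have y: "y t \<in> Rn d" for t
    using x v by (auto simp: y_def topspace_Euclidean_space)
  have "((\<lambda>t. f (y t)) has_real_derivative (\<Sum>i<d. grad d f (y t) i * v i)) (at t)" for t
    using has_gradient_DERIV_line[OF x v] L0_L1_smooth_has_gradient[OF smooth y]
    unfolding y_def by blast
  then obtain z where z: "0 < z" "z < 1"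
    and mvt: "f (y 1) - f (y 0) = (1 - 0) * (\<Sum>i<d. grad d f (y z) i * v i)"
    using MVT2[of 0 1 "\<lambda>t. f (y t)" "\<lambda>t. \<Sum>i<d. grad d f (y t) i * v i"] by auto
  have "edist d x (y z) = z * enorm d v"
    using z(1) by (simp add: y_def L2_set_def power_mult_distrib real_sqrt_mult
        flip: sum_distrib_left)
  also have "\<dots> \<le> enorm d v"
    using z by (simp add: mult_left_le_one_le L2_set_nonneg)
  finally have dist: "edist d x (y z) \<le> enorm d v" .
  \<comment> \<open>Smoothness is not symmetric in its two points: with \<open>x\<close> as the
    first one, \<open>K\<close> contains the gradient norm at \<open>x\<close> and not at the
    unknown \<open>y z\<close>.\<close>
  have "edist d (grad d f x) (grad d f (y z)) \<le> K * edist d x (y z)"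
    using smooth x y[of z] short dist unfolding L0_L1_smooth_def K_def by fastforce
  also have "\<dots> \<le> K * enorm d v" using dist K by (rule mult_left_mono)
  finally have grad_le: "edist d (grad d f x) (grad d f (y z)) \<le> K * enorm d v" .
  have "(\<Sum>i<d. grad d f (y z) i * v i) - (\<Sum>i<d. grad d f x i * v i)
      = (\<Sum>i<d. (grad d f (y z) i - grad d f x i) * v i)"
    by (simp add: sum_subtractf left_diff_distrib)
  also have "\<dots> \<le> (\<Sum>i<d. \<bar>grad d f x i - grad d f (y z) i\<bar> * \<bar>v i\<bar>)"
    by (intro sum_mono) (metis abs_ge_self abs_minus_commute abs_mult)
  also have "\<dots> \<le> edist d (grad d f x) (grad d f (y z)) * enorm d v"
    by (rule L2_set_mult_ineq)
  also have "\<dots> \<le> K * enorm d v * enorm d v"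
    using grad_le by (intro mult_right_mono L2_set_nonneg)
  finally show ?thesis
    using mvt by (simp add: y_def K_def power2_eq_square mult_ac)
qed

text \<open>The clipped step is a gradient step of size \<open>s = \<eta> * min 1 (c / n)\<close>,
  whose first-order decrease \<open>s * n\<^sup>2\<close> is
  \<open>\<eta> * min (n\<^sup>2) (c * n)\<close>; the quadratic error consumes at most half of it.
  The alternative \<open>L0 + c * L1 = 0\<close> stands for an infinite bound on
  \<open>\<eta>\<close>, since division by zero yields 0.\<close>

lemma clip_step_decrease:
  assumes smooth: "L0_L1_smooth d L0 L1 f" and L: "L0 \<ge> 0" "L1 \<ge> 0"
    and c: "c > 0" and \<eta>: "\<eta> > 0" and step: "L0 + c * L1 = 0 \<or> \<eta> \<le> 1 / (9 * (L0 + c * L1))"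
    and x: "x \<in> Rn d"
  shows "f (\<lambda>i. x i - \<eta> * clip d c (grad d f x) i)
           \<le> f x - \<eta> / 2 * min ((enorm d (grad d f x))\<^sup>2) (c * enorm d (grad d f x))"
proof (cases "enorm d (grad d f x) = 0")
  \<comment> \<open>Here \<open>c / 0 = 0\<close> makes the clipped gradient zero, so the point does
    not move, and the minimum is zero too.\<close>
  case True
  then show ?thesis by (simp add: clip_def)
next
  case False
  define g where "g = grad d f x"
  define n where "n = enorm d g"
  define s where "s = \<eta> * min 1 (c / n)"
  define v where "v = (\<lambda>i. - s * g i)"
  have n: "n > 0" using False L2_set_nonneg[of g "{..<d}"] by (simp add: n_def g_def less_le)
  have s: "s > 0" using n c \<eta> by (simp add: s_def)
  have "g \<in> Rn d" using L0_L1_smooth_has_gradient[OF smooth x] by (simp add: has_gradient_def g_def)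
  then have v: "v \<in> Rn d" by (simp add: v_def topspace_Euclidean_space)
  have norm_v: "enorm d v = s * n"
    using s by (simp add: v_def n_def L2_set_def power_mult_distrib real_sqrt_mult
        flip: sum_distrib_left)
  have \<eta>L: "9 * (\<eta> * (L0 + c * L1)) \<le> 1"
  proof (cases "L0 + c * L1 = 0")
    case False
    moreover have "L0 + c * L1 \<ge> 0" using L c by simp
    ultimately have "L0 + c * L1 > 0" by linarith
    then show ?thesis using step by (simp add: field_simps)
  qed simp
  \<comment> \<open>The effect of clipping: the first bound controls the \<open>L0\<close> part of
    the curvature, the second one the \<open>L1\<close> part, however large \<open>n\<close>
    is.\<close>
  have s_le: "s \<le> \<eta>" "s * n \<le> \<eta> * c"
    using n \<eta> by (auto simp: s_def min_def field_simps)
  have "s * (L0 + L1 * n) = s * L0 + L1 * (s * n)" by (simp add: algebra_simps)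
  also have "\<dots> \<le> \<eta> * L0 + L1 * (\<eta> * c)"
    using s_le L by (intro add_mono mult_right_mono mult_left_mono) auto
  also have "\<dots> = \<eta> * (L0 + c * L1)" by (simp add: algebra_simps)
  finally have sK: "s * (L0 + L1 * n) \<le> 1 / 2" using \<eta>L by linarith
  \<comment> \<open>The same bound \<open>s * n \<le> \<eta> * c\<close> keeps the step within the
    radius on which smoothness applies.\<close>
  have short: "L1 = 0 \<or> enorm d v \<le> 1 / L1"
  proof (cases "L1 = 0")
    case False
    have "L1 * (s * n) \<le> L1 * (\<eta> * c)" using s_le L by (intro mult_left_mono)
    also have "\<dots> \<le> \<eta> * (L0 + c * L1)" using \<eta> L by (simp add: algebra_simps)
    finally have "L1 * (s * n) \<le> 1" using \<eta>L by linarith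
    then show ?thesis using False L by (simp add: norm_v field_simps)
  qed simp
  have "(\<Sum>i<d. g i * v i) = - s * (\<Sum>i<d. (g i)\<^sup>2)"
    by (simp add: v_def sum_distrib_left power2_eq_square sum_negf mult_ac)
  also have "(\<Sum>i<d. (g i)\<^sup>2) = n\<^sup>2" by (simp add: n_def L2_set_def sum_nonneg)
  finally have inner: "(\<Sum>i<d. g i * v i) = - s * n\<^sup>2" .
  have "f (\<lambda>i. x i + v i) \<le> f x - s * n\<^sup>2 + (L0 + L1 * n) * (s * n)\<^sup>2"
    using L0_L1_smooth_upper_bound[OF smooth L x v short] inner
    unfolding norm_v by (simp flip: g_def n_def)
  also have "(L0 + L1 * n) * (s * n)\<^sup>2 = s * (L0 + L1 * n) * (s * n\<^sup>2)"
    by (simp add: power2_eq_square mult_ac)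
  also have "\<dots> \<le> 1 / 2 * (s * n\<^sup>2)" using sK s by (intro mult_right_mono) auto
  also have "f x - s * n\<^sup>2 + 1 / 2 * (s * n\<^sup>2) = f x - (s * n\<^sup>2) / 2" by simp
  also have "s * n\<^sup>2 = \<eta> * min (n\<^sup>2) (c * n)"
    using n by (auto simp: s_def min_def field_simps power2_eq_square)
  finally have "f (\<lambda>i. x i + v i) \<le> f x - \<eta> / 2 * min (n\<^sup>2) (c * n)" by simp
  moreover have "(\<lambda>i. x i + v i) = (\<lambda>i. x i - \<eta> * clip d c g i)"
    by (simp add: v_def s_def clip_def n_def mult_ac)
  ultimately show ?thesis by (simp flip: g_def add: n_def)
qed

text \<open>For each \<open>a > 0\<close> both branches of the minimum \<open>m\<close> satisfy
  \<open>n \<le> a / 2 + m * (1 / (2 * a) + 1 / c)\<close>: the quadratic one by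
  \<open>0 \<le> (n - a)\<^sup>2\<close>, the linear one because \<open>m / c = n\<close>. Averaging
  comes first, and \<open>a\<close> is chosen afterwards in terms of \<open>M\<close>.\<close>

lemma average_le_of_average_min_le:
  fixes n :: "'a \<Rightarrow> real"
  assumes A: "finite A" "A \<noteq> {}" and c: "c > 0" and nonneg: "\<And>t. t \<in> A \<Longrightarrow> n t \<ge> 0"
    and M: "(\<Sum>t\<in>A. min ((n t)\<^sup>2) (c * n t)) / card A \<le> M"
  shows "(\<Sum>t\<in>A. n t) / card A \<le> sqrt M + M / c"
proof -
  define m where "m = (\<lambda>t. min ((n t)\<^sup>2) (c * n t))"
  have card: "real (card A) > 0" using A by (simp add: card_gt_0_iff)
  have m: "m t \<ge> 0" if "t \<in> A" for t using nonneg[OF that] c by (simp add: m_def)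
  have "0 \<le> (\<Sum>t\<in>A. m t) / card A" using m by (intro divide_nonneg_nonneg sum_nonneg) auto
  then have M0: "M \<ge> 0" using M by (simp add: m_def)
  have le: "(\<Sum>t\<in>A. n t) / card A \<le> a / 2 + M / (2 * a) + M / c" if a: "a > 0" for a
  proof -
    have "n t \<le> a / 2 + m t * (1 / (2 * a) + 1 / c)" if t: "t \<in> A" for t
    proof (cases "(n t)\<^sup>2 \<le> c * n t")
      case True
      have "0 \<le> (n t - a)\<^sup>2" by simp
      then have "n t \<le> a / 2 + (n t)\<^sup>2 / (2 * a)"
        using a by (simp add: field_simps power2_eq_square)
      moreover have "0 \<le> (n t)\<^sup>2 / c" using c by simp
      ultimately show ?thesis using True by (simp add: m_def distrib_left)
    next
      case False
      then have "m t / c = n t" using c by (simp add: m_def)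
      moreover have "0 \<le> m t / (2 * a)" using m[OF t] a by simp
      ultimately show ?thesis using a by (simp add: distrib_left)
    qed
    then have "(\<Sum>t\<in>A. n t) \<le> (\<Sum>t\<in>A. a / 2 + m t * (1 / (2 * a) + 1 / c))"
      by (rule sum_mono)
    also have "\<dots> = card A * (a / 2) + (\<Sum>t\<in>A. m t) * (1 / (2 * a) + 1 / c)"
      by (simp add: sum.distrib sum_distrib_right)
    finally have "(\<Sum>t\<in>A. n t) / card A
        \<le> (card A * (a / 2) + (\<Sum>t\<in>A. m t) * (1 / (2 * a) + 1 / c)) / card A"
      by (rule divide_right_mono) simp
    also have "\<dots> = a / 2 + (\<Sum>t\<in>A. m t) / card A * (1 / (2 * a) + 1 / c)"
      using card by (simp add: add_divide_distrib)
    also have "\<dots> \<le> a / 2 + M * (1 / (2 * a) + 1 / c)"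
      using M a c by (intro add_left_mono mult_right_mono) (auto simp: m_def)
    finally show ?thesis by (simp add: distrib_left)
  qed
  show ?thesis
  proof (cases "M = 0")
    \<comment> \<open>The choice \<open>a = sqrt M\<close> would be zero here; instead the bound
      \<open>a / 2\<close> holds for every \<open>a > 0\<close>, and \<open>a\<close> tends to
      0.\<close>
    case True
    have "(\<Sum>t\<in>A. n t) / card A \<le> 0"
    proof (rule field_le_epsilon)
      fix e :: real
      assume "e > 0"
      then show "(\<Sum>t\<in>A. n t) / card A \<le> 0 + e" using le[of "2 * e"] True by simp
    qed
    then show ?thesis using True by simp
  next
    case False
    \<comment> \<open>The minimum of \<open>a / 2 + M / (2 * a)\<close> is attained at
      \<open>a = sqrt M\<close> and equals \<open>sqrt M\<close>.\<close>
    have "M / (2 * sqrt M) = M / sqrt M / 2" by simp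
    also have "\<dots> = sqrt M / 2" using M0 by (simp only: real_div_sqrt)
    finally have "M / (2 * sqrt M) = sqrt M / 2" .
    then show ?thesis using le[of "sqrt M"] False M0 by simp
  qed
qed

theorem theorem2p1:
  shows "\<exists>C::real. C > 0 \<and>
    (\<forall>(d::nat) (L0::real) (L1::real) (f :: (nat \<Rightarrow> real) \<Rightarrow> real) (c::real) (\<eta>::real)
        (x :: nat \<Rightarrow> nat \<Rightarrow> real).
      L0 \<ge> 0 \<longrightarrow> L1 \<ge> 0 \<longrightarrow> L0_L1_smooth d L0 L1 f \<longrightarrow> bdd_below (f ` Rn d) \<longrightarrow>
      c > 0 \<longrightarrow> \<eta> > 0 \<longrightarrow> (L0 + c * L1 = 0 \<or> \<eta> \<le> 1 / (9 * (L0 + c * L1))) \<longrightarrow>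
      x 0 \<in> Rn d \<longrightarrow> (\<forall>t. x (Suc t) = (\<lambda>i. x t i - \<eta> * clip d c (grad d f (x t)) i)) \<longrightarrow>
      (\<forall>T::nat. T \<ge> 1 \<longrightarrow>
        (let F0 = f (x 0) - (INF y\<in>Rn d. f y) in
          (1 / real T) * (\<Sum>t=1..T. enorm d (grad d f (x t)))
            \<le> C * (sqrt (F0 / (\<eta> * real T)) + F0 / (\<eta> * real T * c)))))"
proof (intro exI[of _ "2::real"] conjI allI impI)
  \<comment> \<open>The witness 2 comes from the factor 1/2 in the decrease per step: the average of
    the minima is at most \<open>2 * M\<close>, which gives 2 in the linear term and
    \<open>sqrt 2 \<le> 2\<close> in the root.\<close>
  fix d T :: nat and L0 L1 c \<eta> :: real and f :: "(nat \<Rightarrow> real) \<Rightarrow> real"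
    and x :: "nat \<Rightarrow> nat \<Rightarrow> real"
  assume L: "L0 \<ge> 0" "L1 \<ge> 0" and smooth: "L0_L1_smooth d L0 L1 f"
    and bdd: "bdd_below (f ` Rn d)" and c: "c > 0" and \<eta>: "\<eta> > 0"
    and step: "L0 + c * L1 = 0 \<or> \<eta> \<le> 1 / (9 * (L0 + c * L1))"
    and x0: "x 0 \<in> Rn d"
    and rec: "\<forall>t. x (Suc t) = (\<lambda>i. x t i - \<eta> * clip d c (grad d f (x t)) i)"
    and T: "T \<ge> 1"
  define n where "n = (\<lambda>t. enorm d (grad d f (x t)))"
  define m where "m = (\<lambda>t. min ((n t)\<^sup>2) (c * n t))"
  define F0 where "F0 = f (x 0) - (INF y\<in>Rn d. f y)"
  define M where "M = F0 / (\<eta> * T)"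
  have n: "n t \<ge> 0" for t by (simp add: n_def L2_set_nonneg)
  have x: "x t \<in> Rn d" for t
  proof (induction t)
    case (Suc t)
    then have "grad d f (x t) \<in> Rn d"
      using L0_L1_smooth_has_gradient[OF smooth] by (simp add: has_gradient_def)
    then show ?case using Suc rec by (simp add: clip_def topspace_Euclidean_space)
  qed (fact x0)
  have decrease: "f (x (Suc t)) \<le> f (x t) - \<eta> / 2 * m t" for t
    using clip_step_decrease[OF smooth L c \<eta> step x[of t]] rec by (simp add: m_def n_def)
  \<comment> \<open>The average starts at index 1 while \<open>F0\<close> is measured at
    \<open>x 0\<close>: the nonnegative decrease of the first step is dropped, and the step from
    \<open>x T\<close> to \<open>x (Suc T)\<close> supplies the last summand.\<close>
  have "f (x (Suc t)) \<le> f (x 0) - \<eta> / 2 * (\<Sum>k=1..t. m k)" for t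
  proof (induction t)
    case 0
    have "0 \<le> \<eta> / 2 * m 0" using n[of 0] c \<eta> by (simp add: m_def)
    then show ?case using decrease[of 0] by simp
  next
    case (Suc t)
    then show ?case using decrease[of "Suc t"] by (simp add: algebra_simps)
  qed
  moreover have "(INF y\<in>Rn d. f y) \<le> f (x (Suc T))" using bdd x by (rule cINF_lower)
  ultimately have "\<eta> / 2 * (\<Sum>k=1..T. m k) \<le> F0"
    unfolding F0_def by (smt (verit))
  then have "(\<Sum>k=1..T. m k) / card {1..T} \<le> 2 * M"
    using \<eta> T by (simp add: M_def field_simps)
  then have avg: "(\<Sum>k=1..T. n k) / T \<le> sqrt (2 * M) + 2 * M / c"
    using average_le_of_average_min_le[of "{1..T}" c n "2 * M"] T c n by (simp add: m_def)
  have "F0 \<ge> 0" using cINF_lower[OF bdd x0] by (simp add: F0_def)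
  then have M: "M \<ge> 0" using \<eta> by (simp add: M_def)
  have "sqrt (2 * M) \<le> sqrt (2\<^sup>2 * M)" using M by (intro real_sqrt_le_mono mult_right_mono) auto
  also have "\<dots> = 2 * sqrt M" by (simp add: real_sqrt_mult)
  finally show "let F0 = f (x 0) - (INF y\<in>Rn d. f y) in
      (1 / real T) * (\<Sum>t=1..T. enorm d (grad d f (x t)))
        \<le> 2 * (sqrt (F0 / (\<eta> * real T)) + F0 / (\<eta> * real T * c))"
    using avg unfolding Let_def F0_def[symmetric]
    by (simp add: M_def n_def)
qed simp

end
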